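(* The functional equation $$\frac14+f(x)f(y)-f(x+y)\big(f(x)+f(y)\big)-\frac{f(x+y)-f(y)}{x}-\frac{f(x+y)-f(x)}{y}-\frac{f(x)+f(y)}{x+y}=0,\qquad x\neq0,\ y\neq0,\ x+y\neq0,$$ has a unique odd holomorphic solution around the origin, namely $f(x)=\frac12\coth\frac x2-\frac1x$. That is: this function (with $f(0)=0$) is odd, holomorphic near $0$, and satisfies the equation whenever $x,y,x+y$ are nonzero and lie in its domain of holomorphy $\mathbf{C}\setminus2\pi i\mathbf{Z}^*$; and if $U\subset\mathbf{C}$ is an open neighbourhood of $0$ with $-U=U$ and $g:U\to\mathbf{C}$ is an odd holomorphic function satisfying the equation (with $g$ in place of $f$) for all nonzero $x,y\in U$ with $0\neq x+y\in U$, then $g(x)=\frac12\coth\frac x2-\frac1x$ for all nonzero $x$ in some neighbourhood of $0$.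
   Context: Here $\mathbf{Z}^*=\mathbf{Z}\setminus\{0\}$. The function $\frac12\coth\frac x2-\frac1x$ has a removable singularity at $x=0$ and is extended by the value $0$ there. *)

theory Defs
  imports "HOL-Complex_Analysis.Complex_Analysis"
begin

definition coth :: "complex \<Rightarrow> complex" where
  "coth z = cosh z / sinh z"

(* The value at 0 is the removable singularity filled in. At the poles, i.e. at the
   nonzero multiples of 2 * pi * \<i>, the value is a meaningless artefact of division
   by zero; these points are excluded by coth_domain. *)
definition coth_fun :: "complex \<Rightarrow> complex" where
  "coth_fun x = (if x = 0 then 0 else 1 / 2 * coth (x / 2) - 1 / x)"

definition coth_domain :: "complex set" where
  "coth_domain = UNIV - {2 * of_real pi * \<i> * of_int n | n :: int. n \<noteq> 0}"

definition fun_eq_at :: "(complex \<Rightarrow> complex) \<Rightarrow> complex \<Rightarrow> complex \<Rightarrow> bool" where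
  "fun_eq_at f x y \<longleftrightarrow>
     1 / 4 + f x * f y - f (x + y) * (f x + f y)
       - (f (x + y) - f y) / x - (f (x + y) - f x) / y - (f x + f y) / (x + y) = 0"

definition solves_fun_eq_on :: "(complex \<Rightarrow> complex) \<Rightarrow> complex set \<Rightarrow> bool" where
  "solves_fun_eq_on f U \<longleftrightarrow>
     (\<forall>x\<in>U. \<forall>y\<in>U. x \<noteq> 0 \<longrightarrow> y \<noteq> 0 \<longrightarrow> x + y \<noteq> 0 \<longrightarrow> x + y \<in> U \<longrightarrow> fun_eq_at f x y)"

definition odd_on :: "(complex \<Rightarrow> complex) \<Rightarrow> complex set \<Rightarrow> bool" where
  "odd_on f U \<longleftrightarrow> (\<forall>x\<in>U. -x \<in> U \<and> f (-x) = - f x)"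

end

theory Submission
  imports Defs
begin

text \<open>
  Adding the polar part back, that is passing to \<open>h x = f x + 1 / x\<close>, absorbs all the difference
  quotients of the functional equation and turns it into
  \<open>h (x + y) * (h x + h y) = 1 / 4 + h x * h y\<close>. This is the addition formula of
  \<open>h x = coth (x / 2) / 2\<close>, which settles existence
  (\<open>coth_fun_solves\<close>); that the pole of \<open>h\<close> at \<open>0\<close> is exactly cancelled by \<open>1 / x\<close> follows from
  \<open>sinh z / z \<rightarrow> 1\<close>, and oddness then forces the value \<open>0\<close> (\<open>coth_fun_holomorphic\<close>).

  For uniqueness, let \<open>y\<close> tend to \<open>0\<close> in the functional equation. A solution with \<open>g 0 = 0\<close>
  satisfies the Riccati equation \<open>g' = 1 / 4 - g\<^sup>2 - 2 g / x\<close> (\<open>deriv_of_solution\<close>). It is singular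
  at \<open>0\<close>, so the usual uniqueness theorem for initial value problems does not apply, but for two
  solutions \<open>f\<close> and \<open>g\<close> the function \<open>w = x\<^sup>2 (g - f)\<close> satisfies the regular linear equation
  \<open>w' = - (f + g) w\<close> with \<open>w 0 = 0\<close>, so that \<open>w = 0\<close> (\<open>riccati_solution_unique\<close>).
  Comparing a given solution with \<open>coth_fun\<close> completes the proof.
\<close>

section \<open>The hyperbolic cotangent solves the equation\<close>

lemma sinh_complex_eq_0_iff:
  fixes z :: complex
  shows "sinh z = 0 \<longleftrightarrow> (\<exists>n::int. z = of_real pi * \<i> * of_int n)"
proof -
  have "sinh z = 0 \<longleftrightarrow> (\<exists>n::int. \<i> * z = of_real (real_of_int n * pi))"
    by (simp add: sinh_conv_sin sin_eq_0)
  also have "\<dots> \<longleftrightarrow> (\<exists>n::int. z = of_real pi * \<i> * of_int (- n))"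
    by (intro ex_cong1) (auto simp: complex_eq_iff algebra_simps)
  also have "\<dots> \<longleftrightarrow> (\<exists>n::int. z = of_real pi * \<i> * of_int n)"
    by (metis minus_minus)
  finally show ?thesis .
qed

lemma coth_domain_iff: "x \<in> coth_domain \<longleftrightarrow> x = 0 \<or> sinh (x / 2) \<noteq> 0"
proof -
  have "sinh (x / 2) = 0 \<longleftrightarrow> (\<exists>n::int. x = 2 * of_real pi * \<i> * of_int n)"
    unfolding sinh_complex_eq_0_iff by (intro ex_cong1) (auto simp: field_simps)
  then show ?thesis
    by (auto simp: coth_domain_def)
qed

lemma open_coth_domain: "open coth_domain"
proof -
  have "coth_domain = (\<lambda>x. x / (2 * of_real pi * \<i>)) -` (- (of_int ` (UNIV - {0::int})))"
    by (auto simp: coth_domain_def field_simps)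
  moreover have "open \<dots>"
    by (intro open_vimage continuous_intros open_Compl closed_of_int_image) auto
  ultimately show ?thesis by simp
qed

lemma coth_fun_minus: "coth_fun (- x) = - coth_fun x"
  by (simp add: coth_fun_def coth_def)

lemma coth_fun_add_inverse: "x \<noteq> 0 \<Longrightarrow> coth_fun x + 1 / x = coth (x / 2) / 2"
  by (simp add: coth_fun_def)

lemma coth_fun_holomorphic: "coth_fun holomorphic_on coth_domain"
proof -
  have hol: "coth_fun holomorphic_on coth_domain - {0}"
  proof -
    have "(\<lambda>x::complex. sinh (x / 2)) holomorphic_on A" "(\<lambda>x::complex. cosh (x / 2)) holomorphic_on A"
      for A
      unfolding sinh_field_def cosh_field_def by (intro holomorphic_intros; simp)+
    then have "(\<lambda>x. 1 / 2 * (cosh (x / 2) / sinh (x / 2)) - 1 / x) holomorphic_on coth_domain - {0}"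
      by (intro holomorphic_intros) (auto simp: coth_domain_iff)
    then show ?thesis
      by (rule holomorphic_transform) (auto simp: coth_fun_def coth_def)
  qed
  have "((\<lambda>x::complex. sinh (x / 2)) has_field_derivative 1 / 2) (at 0)"
    by (auto intro!: derivative_eq_intros)
  then have lim_sinh: "((\<lambda>x::complex. sinh (x / 2) / x) \<longlongrightarrow> 1 / 2) (at 0)"
    by (simp add: has_field_derivative_iff)
  have "isCont (\<lambda>x::complex. cosh (x / 2)) 0"
    by (rule DERIV_isCont) (auto intro!: derivative_eq_intros)
  then have lim_cosh: "((\<lambda>x::complex. cosh (x / 2)) \<longlongrightarrow> cosh (0 / 2)) (at 0)"
    by (simp add: isCont_def)
  have "((\<lambda>x::complex. 1 / 2 * (cosh (x / 2) / (sinh (x / 2) / x)) - 1)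
      \<longlongrightarrow> 0) (at 0)"
    by (rule tendsto_eq_rhs[OF tendsto_diff[OF tendsto_mult[OF tendsto_const
         tendsto_divide[OF lim_cosh lim_sinh]] tendsto_const]]) auto
  then have "((\<lambda>x. (x - 0) * coth_fun x) \<longlongrightarrow> 0) (at 0)"
    by (rule Lim_transform_eventually)
       (auto simp: eventually_at_filter coth_fun_def coth_def algebra_simps)
  moreover have "0 \<in> interior coth_domain"
    using open_coth_domain by (simp add: interior_open coth_domain_iff)
  ultimately obtain G where G: "G holomorphic_on coth_domain"
    and G_eq: "\<And>x. x \<in> coth_domain - {0} \<Longrightarrow> G x = coth_fun x"
    using holomorphic_on_extend_lim[OF hol] by blast
  have lim: "(coth_fun \<longlongrightarrow> G 0) (at 0)"
  proof -
    have "isCont G 0"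
      using holomorphic_on_imp_continuous_on[OF G] open_coth_domain
      by (simp add: continuous_on_eq_continuous_at coth_domain_iff)
    then have "(G \<longlongrightarrow> G 0) (at 0)"
      by (simp add: isCont_def)
    moreover have "\<forall>\<^sub>F x in at 0. x \<in> coth_domain - {0}"
      using open_coth_domain by (intro eventually_at_in_open) (auto simp: coth_domain_iff)
    ultimately show ?thesis
      by (elim Lim_transform_eventually) (auto elim!: eventually_mono simp: G_eq)
  qed
  \<comment> \<open>An odd function can only have the limit \<open>0\<close> at the origin.\<close>
  have "((\<lambda>x. coth_fun (- x)) \<longlongrightarrow> G 0) (at 0)"
    by (rule filterlim_compose[OF lim])
       (auto simp: filterlim_at eventually_at_filter intro!: tendsto_eq_intros)
  then have "(coth_fun \<longlongrightarrow> - G 0) (at 0)"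
    unfolding coth_fun_minus by (simp add: tendsto_minus_cancel_left)
  then have "G 0 = - G 0"
    using lim tendsto_unique[OF at_neq_bot] by blast
  then have "G 0 = coth_fun 0"
    by (simp add: coth_fun_def)
  then show ?thesis
    using G G_eq by (elim holomorphic_transform) auto
qed

text \<open>
  The change of unknown produces no stray constant or polar term: the contributions
  \<open>1 / (x * y)\<close> from \<open>h x * h y\<close> and from \<open>h (x + y) * (h x + h y)\<close> cancel.
\<close>

lemma fun_eq_at_iff_addition_formula:
  fixes f :: "complex \<Rightarrow> complex"
  defines "h \<equiv> \<lambda>x. f x + 1 / x"
  assumes "x \<noteq> 0" "y \<noteq> 0" "x + y \<noteq> 0"
  shows "fun_eq_at f x y \<longleftrightarrow> h (x + y) * (h x + h y) = 1 / 4 + h x * h y"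
proof -
  have "1 / x + 1 / y = (x + y) * (1 / (x * y))"
    using assms by (simp add: field_simps)
  then have polar: "1 / (x + y) * (1 / x + 1 / y) = 1 / (x * y)"
    using assms by simp
  have eq: "1 / 4 + h x * h y - h (x + y) * (h x + h y)
      = 1 / 4 + f x * f y - f (x + y) * (f x + f y) - (f (x + y) - f y) / x
        - (f (x + y) - f x) / y - (f x + f y) / (x + y)
        + (1 / (x * y) - 1 / (x + y) * (1 / x + 1 / y))"
    by (simp add: h_def algebra_simps diff_divide_distrib add_divide_distrib)
  have "fun_eq_at f x y \<longleftrightarrow> 1 / 4 + h x * h y - h (x + y) * (h x + h y) = 0"
    by (simp only: fun_eq_at_def eq polar diff_self add_0_right)
  then show ?thesis
    by (simp only: right_minus_eq) (rule eq_commute)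
qed

lemma coth_add:
  assumes "sinh a \<noteq> 0" "sinh b \<noteq> 0" "sinh (a + b) \<noteq> 0"
  shows "coth (a + b) * (coth a + coth b) = 1 + coth a * coth b"
proof -
  have "coth a + coth b = sinh (a + b) / (sinh a * sinh b)"
    using assms by (simp add: coth_def sinh_add field_simps)
  then have "coth (a + b) * (coth a + coth b) = cosh (a + b) / (sinh a * sinh b)"
    using assms by (simp add: coth_def)
  also have "\<dots> = 1 + coth a * coth b"
    using assms by (simp add: coth_def cosh_add field_simps)
  finally show ?thesis .
qed

lemma coth_fun_solves: "solves_fun_eq_on coth_fun coth_domain"
  unfolding solves_fun_eq_on_def
proof (intro ballI impI)
  fix x y
  assume dom: "x \<in> coth_domain" "y \<in> coth_domain" "x + y \<in> coth_domain"
    and nz: "x \<noteq> 0" "y \<noteq> 0" "x + y \<noteq> 0"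
  have "coth (x / 2 + y / 2) * (coth (x / 2) + coth (y / 2)) = 1 + coth (x / 2) * coth (y / 2)"
    using dom nz by (intro coth_add) (auto simp: coth_domain_iff add_divide_distrib)
  then show "fun_eq_at coth_fun x y"
    unfolding fun_eq_at_iff_addition_formula[OF nz] coth_fun_add_inverse[OF nz(1)]
      coth_fun_add_inverse[OF nz(2)] coth_fun_add_inverse[OF nz(3)] add_divide_distrib[of x y]
    by (simp add: add_divide_distrib[symmetric] flip: distrib_left)
qed

section \<open>Uniqueness through a Riccati equation\<close>

lemma deriv_of_solution:
  assumes "open U" "0 \<in> U" "g holomorphic_on U" "g 0 = 0" "solves_fun_eq_on g U"
    and x: "x \<in> U" "x \<noteq> 0"
  shows "deriv g x = 1 / 4 - (g x)\<^sup>2 - 2 * g x / x"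
proof -
  define E where "E = (\<lambda>y. 1 / 4 + g x * g y - g (x + y) * (g x + g y)
      - (g (x + y) - g y) / x - (g (x + y) - g x) / y - (g x + g y) / (x + y))"
  have "isCont g 0" "isCont g x"
    using assms holomorphic_on_imp_continuous_on continuous_on_eq_continuous_at by blast+
  then have g0: "(g \<longlongrightarrow> 0) (at 0)" and gx: "((\<lambda>y. g (x + y)) \<longlongrightarrow> g x) (at 0)"
    using \<open>g 0 = 0\<close> LIM_offset_zero[of g "g x" x] by (auto simp: isCont_def)
  have "(g has_field_derivative deriv g x) (at x)"
    using assms by (auto intro: holomorphic_derivI)
  then have dg: "((\<lambda>y. (g (x + y) - g x) / y) \<longlongrightarrow> deriv g x) (at 0)"
    by (simp add: DERIV_def)
  have "(E \<longlongrightarrow> 1 / 4 + g x * 0 - g x * (g x + 0) - (g x - 0) / x - deriv g x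
      - (g x + 0) / (x + 0)) (at 0)"
    unfolding E_def by (intro tendsto_intros g0 gx dg) (use x in auto)
  moreover have "(E \<longlongrightarrow> 0) (at 0)"
  proof (rule tendsto_eventually)
    have "\<forall>\<^sub>F y in at 0. y \<in> (U \<inter> (\<lambda>y. x + y) -` (U - {0})) - {0}"
    proof (intro eventually_at_in_open open_Int open_vimage)
      show "0 \<in> U \<inter> (\<lambda>y. x + y) -` (U - {0})"
        using assms by auto
    qed (auto intro: continuous_intros \<open>open U\<close> open_delete)
    then show "\<forall>\<^sub>F y in at 0. E y = 0"
      using assms(5) x
      by (elim eventually_mono) (auto simp: solves_fun_eq_on_def fun_eq_at_def E_def)
  qed
  ultimately have "1 / 4 + g x * 0 - g x * (g x + 0) - (g x - 0) / x - deriv g x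
      - (g x + 0) / (x + 0) = 0"
    using tendsto_unique[OF at_neq_bot] by blast
  then show ?thesis
    by (simp add: power2_eq_square algebra_simps)
qed

text \<open>
  The factor \<open>x\<^sup>2\<close> is an integrating factor for the singular term \<open>- 2 g / x\<close>. The remaining linear
  equation \<open>w' = - (f + g) w\<close> has holomorphic coefficients, so that \<open>w * exp F\<close> is constant for a
  primitive \<open>F\<close> of \<open>f + g\<close>; the constant is \<open>0\<close> because \<open>w\<close> vanishes at the origin.
\<close>

lemma riccati_solution_unique:
  fixes f g :: "complex \<Rightarrow> complex"
  assumes B: "open B" "convex B" "0 \<in> B"
    and hol: "f holomorphic_on B" "g holomorphic_on B"
    and f: "\<And>x. x \<in> B \<Longrightarrow> x \<noteq> 0 \<Longrightarrow> deriv f x = c - (f x)\<^sup>2 - 2 * f x / x"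
    and g: "\<And>x. x \<in> B \<Longrightarrow> x \<noteq> 0 \<Longrightarrow> deriv g x = c - (g x)\<^sup>2 - 2 * g x / x"
    and x: "x \<in> B" "x \<noteq> 0"
  shows "g x = f x"
proof -
  define w where "w = (\<lambda>z. z\<^sup>2 * (g z - f z))"
  obtain F where F: "\<And>z. z \<in> B \<Longrightarrow> (F has_field_derivative f z + g z) (at z within B)"
    using holomorphic_convex_primitive'[OF B(2,1), of "\<lambda>z. f z + g z"] hol
    by (auto intro: holomorphic_intros)
  have w: "(w has_field_derivative - (f z + g z) * w z) (at z within B)" if z: "z \<in> B" for z
  proof -
    have "(w has_field_derivative 2 * z * (g z - f z) + z\<^sup>2 * (deriv g z - deriv f z)) (at z)"
      unfolding w_def
      by (rule derivative_eq_intros holomorphic_derivI[OF hol(1) B(1) z]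
           holomorphic_derivI[OF hol(2) B(1) z] refl)+ (simp add: algebra_simps)
    also have "2 * z * (g z - f z) + z\<^sup>2 * (deriv g z - deriv f z) = - (f z + g z) * w z"
    proof (cases "z = 0")
      case False
      then show ?thesis
        unfolding f[OF z False] g[OF z False] w_def by (simp add: field_simps power2_eq_square)
    qed (simp add: w_def)
    finally show ?thesis
      by (rule has_field_derivative_at_within)
  qed
  have "\<exists>k. \<forall>z\<in>B. w z * exp (F z) = k"
  proof (rule has_field_derivative_zero_constant[OF B(2)])
    fix z assume z: "z \<in> B"
    show "((\<lambda>z. w z * exp (F z)) has_field_derivative 0) (at z within B)"
      by (rule derivative_eq_intros w[OF z] F[OF z] refl)+ (simp add: algebra_simps)
  qed
  then have "w x * exp (F x) = w 0 * exp (F 0)"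
    using x B by metis
  then show ?thesis
    using x by (simp add: w_def)
qed

theorem mainTheorem2:
  shows "(open coth_domain \<and> 0 \<in> coth_domain \<and> coth_fun holomorphic_on coth_domain
      \<and> odd_on coth_fun coth_domain \<and> solves_fun_eq_on coth_fun coth_domain)
    \<and> (\<forall>(U :: complex set) (g :: complex \<Rightarrow> complex).
           open U \<and> 0 \<in> U \<and> uminus ` U = U \<and> g holomorphic_on U \<and> odd_on g U
             \<and> solves_fun_eq_on g U
           \<longrightarrow> (\<exists>V. open V \<and> 0 \<in> V \<and> V \<subseteq> U
                 \<and> (\<forall>x\<in>V. x \<noteq> 0 \<longrightarrow> g x = 1 / 2 * coth (x / 2) - 1 / x)))"
proof (intro conjI allI impI)
  show "open coth_domain" "coth_fun holomorphic_on coth_domain"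
    "solves_fun_eq_on coth_fun coth_domain"
    by (rule open_coth_domain coth_fun_holomorphic coth_fun_solves)+
  show "0 \<in> coth_domain"
    by (simp add: coth_domain_iff)
  show "odd_on coth_fun coth_domain"
    by (auto simp: odd_on_def coth_domain_iff coth_fun_minus)
next
  fix U :: "complex set" and g :: "complex \<Rightarrow> complex"
  assume "open U \<and> 0 \<in> U \<and> uminus ` U = U \<and> g holomorphic_on U \<and> odd_on g U
    \<and> solves_fun_eq_on g U"
  then have U: "open U" "0 \<in> U" "g holomorphic_on U" "solves_fun_eq_on g U"
    and odd: "odd_on g U" by auto
  have "g 0 = - g 0"
    using odd U(2) by (force simp: odd_on_def)
  then have g0: "g 0 = 0" by simp
  have zero: "0 \<in> coth_domain" "coth_fun 0 = 0"
    by (auto simp: coth_domain_iff coth_fun_def)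
  obtain r where r: "r > 0" "ball 0 r \<subseteq> U \<inter> coth_domain"
    using U zero open_coth_domain open_contains_ball by (metis IntI open_Int)
  have "g x = coth_fun x" if "x \<in> ball 0 r" "x \<noteq> 0" for x
  proof (rule riccati_solution_unique[of "ball 0 r" coth_fun g "1 / 4"])
    show "coth_fun holomorphic_on ball 0 r" "g holomorphic_on ball 0 r"
      using r U coth_fun_holomorphic holomorphic_on_subset by blast+
    show "deriv coth_fun z = 1 / 4 - (coth_fun z)\<^sup>2 - 2 * coth_fun z / z"
      if "z \<in> ball 0 r" "z \<noteq> 0" for z
      using that r zero open_coth_domain coth_fun_holomorphic coth_fun_solves
      by (intro deriv_of_solution[of coth_domain]) auto
    show "deriv g z = 1 / 4 - (g z)\<^sup>2 - 2 * g z / z" if "z \<in> ball 0 r" "z \<noteq> 0" for z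
      using that r U g0 by (intro deriv_of_solution[of U]) auto
  qed (use that r in auto)
  then show "\<exists>V. open V \<and> 0 \<in> V \<and> V \<subseteq> U
      \<and> (\<forall>x\<in>V. x \<noteq> 0 \<longrightarrow> g x = 1 / 2 * coth (x / 2) - 1 / x)"
    using r by (intro exI[of _ "ball 0 r"]) (auto simp: coth_fun_def)
qed

end
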